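(* Let $\alpha\in(2,3)$, let $x_a,x_a^1,K\in\mathbb R$ and $v\in(a,b]$, let $f:[a,b]\times\mathbb R\to\mathbb R$ be continuous, let $\psi:[a,b]\to\mathbb R$ be an increasing differentiable function with $\psi'(t)\neq0$ for all $t\in[a,b]$, and assume $$N:=\frac{2K}{\Gamma(3+\alpha)}(\psi(v)-\psi(a))^{2+\alpha}-(\psi(b)-\psi(a))^2\neq0.$$ For $x\in C^2[a,b]$, the problem $$\begin{cases}{}^CD_{a+}^{\alpha,\psi}x(t)=f(t,x(t)),\quad t\in[a,b],\\ x(a)=x_a,\\ x'(a)=x_a^1,\\ x(b)=K\,I_{a+}^{\alpha,\psi}x(v)\end{cases}$$ is equivalent to the integral equation $$x(t)=I_{a+}^{\alpha,\psi}f(t,x(t))+x_a+\frac{x_a^1}{\psi'(a)}(\psi(t)-\psi(a))+\gamma_x(\psi(t)-\psi(a))^2,\quad t\in[a,b],$$ where $$\gamma_x:=\frac1N\Big[I_{a+}^{\alpha,\psi}f(b,x(b))-K\,I_{a+}^{2\alpha,\psi}f(v,x(v))+x_a\Big(1-\frac{K}{\Gamma(1+\alpha)}(\psi(v)-\psi(a))^\alpha\Big)+\frac{x_a^1}{\psi'(a)}\Big(\psi(b)-\psi(a)-\frac{K}{\Gamma(2+\alpha)}(\psi(v)-\psi(a))^{1+\alpha}\Big)\Big].$$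
   Context: For $\beta>0$ and an integrable function $y:[a,b]\to\mathbb R$, the $\psi$-Riemann--Liouville fractional integral is $$I_{a+}^{\beta,\psi}y(t)=\frac{1}{\Gamma(\beta)}\int_a^t\psi'(\tau)(\psi(t)-\psi(\tau))^{\beta-1}y(\tau)\,d\tau.$$ Notation: $I_{a+}^{\beta,\psi}f(s,x(s))$ denotes the $\psi$-fractional integral of the function $\tau\mapsto f(\tau,x(\tau))$ evaluated at the point $s$ (for $s=t,b,v$), and $I_{a+}^{\alpha,\psi}x(v)$ is $I_{a+}^{\alpha,\psi}x$ evaluated at $v$. With $n=[\alpha]+1$ (so $n=3$ for $\alpha\in(2,3)$), the $\psi$-Riemann--Liouville fractional derivative is $$D_{a+}^{\alpha,\psi}x(t)=\Big(\frac{1}{\psi'(t)}\frac{d}{dt}\Big)^n I_{a+}^{n-\alpha,\psi}x(t),$$ and, for $x\in C^{n-1}[a,b]$, the $\psi$-Caputo fractional derivative is $${}^CD_{a+}^{\alpha,\psi}x(t)=D_{a+}^{\alpha,\psi}\Big[x(t)-\sum_{k=0}^{n-1}\frac{x_\psi^{[k]}(a)}{k!}(\psi(t)-\psi(a))^k\Big],\qquad x_\psi^{[k]}(t)=\Big(\frac{1}{\psi'(t)}\frac{d}{dt}\Big)^kx(t).$$ *)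

theory Defs
  imports "HOL-Analysis.Analysis"
begin

text \<open>
  Functions on \<open>[a,b]\<close> are total functions \<open>real \<Rightarrow> real\<close> of which only the values on
  \<open>{a..b}\<close> matter; so derivatives are taken within \<open>{a..b}\<close> (one-sided at \<open>a\<close> and \<open>b\<close>).
\<close>

definition deriv_on :: "real \<Rightarrow> real \<Rightarrow> (real \<Rightarrow> real) \<Rightarrow> real \<Rightarrow> real" where
  "deriv_on a b g t = vector_derivative g (at t within {a..b})"

definition C_k_on :: "nat \<Rightarrow> real \<Rightarrow> real \<Rightarrow> (real \<Rightarrow> real) \<Rightarrow> bool" where
  "C_k_on k a b g \<longleftrightarrow>
     (\<forall>j<k. (deriv_on a b ^^ j) g differentiable_on {a..b}) \<and>
     continuous_on {a..b} ((deriv_on a b ^^ k) g)"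

definition psi_integrand ::
    "real \<Rightarrow> real \<Rightarrow> (real \<Rightarrow> real) \<Rightarrow> real \<Rightarrow> (real \<Rightarrow> real) \<Rightarrow> real \<Rightarrow> real \<Rightarrow> real" where
  "psi_integrand a b \<psi> \<beta> y t \<tau> =
     deriv_on a b \<psi> \<tau> * (\<psi> t - \<psi> \<tau>) powr (\<beta> - 1) * y \<tau>"

definition psi_RL_integral ::
    "real \<Rightarrow> real \<Rightarrow> (real \<Rightarrow> real) \<Rightarrow> real \<Rightarrow> (real \<Rightarrow> real) \<Rightarrow> real \<Rightarrow> real" where
  "psi_RL_integral a b \<psi> \<beta> y t =
     1 / Gamma \<beta> * integral {a..t} (psi_integrand a b \<psi> \<beta> y t)"

text \<open>The operator \<open>(1/\<psi>') d/dt\<close>; its \<open>k\<close>-th iterate applied to \<open>x\<close> is \<open>x\<^sub>\<psi>\<^sup>[\<^sup>k\<^sup>]\<close>.\<close>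

definition psi_deriv ::
    "real \<Rightarrow> real \<Rightarrow> (real \<Rightarrow> real) \<Rightarrow> (real \<Rightarrow> real) \<Rightarrow> real \<Rightarrow> real" where
  "psi_deriv a b \<psi> g t = 1 / deriv_on a b \<psi> t * deriv_on a b g t"

text \<open>
  Since \<open>vector_derivative\<close> is total, existence of the iterated derivatives has to be
  recorded separately. The \<open>k\<close>-th iterate exists at \<open>t\<close> if the previous one exists at \<open>t\<close>
  and near \<open>t\<close> in \<open>[a,b]\<close>, and is differentiable at \<open>t\<close>.
\<close>

primrec psi_deriv_exists ::
    "nat \<Rightarrow> real \<Rightarrow> real \<Rightarrow> (real \<Rightarrow> real) \<Rightarrow> (real \<Rightarrow> real) \<Rightarrow> real \<Rightarrow> bool" where
  "psi_deriv_exists 0 a b \<psi> g t \<longleftrightarrow> True"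
| "psi_deriv_exists (Suc k) a b \<psi> g t \<longleftrightarrow>
     psi_deriv_exists k a b \<psi> g t \<and>
     (\<forall>\<^sub>F s in at t within {a..b}. psi_deriv_exists k a b \<psi> g s) \<and>
     (psi_deriv a b \<psi> ^^ k) g differentiable (at t within {a..b})"

definition frac_order :: "real \<Rightarrow> nat" where
  "frac_order \<alpha> = nat \<lfloor>\<alpha>\<rfloor> + 1"

definition psi_RL_deriv ::
    "real \<Rightarrow> real \<Rightarrow> (real \<Rightarrow> real) \<Rightarrow> real \<Rightarrow> (real \<Rightarrow> real) \<Rightarrow> real \<Rightarrow> real" where
  "psi_RL_deriv a b \<psi> \<alpha> x =
     (psi_deriv a b \<psi> ^^ frac_order \<alpha>)
       (psi_RL_integral a b \<psi> (real (frac_order \<alpha>) - \<alpha>) x)"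

definition psi_RL_deriv_exists ::
    "real \<Rightarrow> real \<Rightarrow> (real \<Rightarrow> real) \<Rightarrow> real \<Rightarrow> (real \<Rightarrow> real) \<Rightarrow> real \<Rightarrow> bool" where
  "psi_RL_deriv_exists a b \<psi> \<alpha> x t \<longleftrightarrow>
     (\<forall>s\<in>{a..b}. psi_integrand a b \<psi> (real (frac_order \<alpha>) - \<alpha>) x s
                   absolutely_integrable_on {a..s}) \<and>
     psi_deriv_exists (frac_order \<alpha>) a b \<psi>
       (psi_RL_integral a b \<psi> (real (frac_order \<alpha>) - \<alpha>) x) t"

definition psi_Taylor ::
    "real \<Rightarrow> real \<Rightarrow> (real \<Rightarrow> real) \<Rightarrow> nat \<Rightarrow> (real \<Rightarrow> real) \<Rightarrow> real \<Rightarrow> real" where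
  "psi_Taylor a b \<psi> n x t =
     (\<Sum>k<n. (psi_deriv a b \<psi> ^^ k) x a / fact k * (\<psi> t - \<psi> a) ^ k)"

definition psi_Caputo_deriv ::
    "real \<Rightarrow> real \<Rightarrow> (real \<Rightarrow> real) \<Rightarrow> real \<Rightarrow> (real \<Rightarrow> real) \<Rightarrow> real \<Rightarrow> real" where
  "psi_Caputo_deriv a b \<psi> \<alpha> x =
     psi_RL_deriv a b \<psi> \<alpha> (\<lambda>t. x t - psi_Taylor a b \<psi> (frac_order \<alpha>) x t)"

definition psi_Caputo_deriv_exists ::
    "real \<Rightarrow> real \<Rightarrow> (real \<Rightarrow> real) \<Rightarrow> real \<Rightarrow> (real \<Rightarrow> real) \<Rightarrow> real \<Rightarrow> bool" where
  "psi_Caputo_deriv_exists a b \<psi> \<alpha> x t \<longleftrightarrow>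
     (\<forall>k<frac_order \<alpha>. psi_deriv_exists k a b \<psi> x a) \<and>
     psi_RL_deriv_exists a b \<psi> \<alpha> (\<lambda>t. x t - psi_Taylor a b \<psi> (frac_order \<alpha>) x t) t"

end

theory Submission
  imports Defs
begin

text \<open>
  Since \<open>\<psi>\<close> is strictly increasing with nonvanishing derivative, the substitution
  \<open>\<theta> t = \<psi> t - \<psi> a\<close> turns \<open>I\<^sup>\<beta>\<^sup>,\<^sup>\<psi>\<close> into the classical Riemann--Liouville integral, even when
  \<open>\<psi>'\<close> is discontinuous. For this integral the semigroup law holds on monomials by Euler's Beta
  integral, and on continuous functions by Weierstrass approximation; no Fubini argument is needed.

  Write \<open>R\<close> for \<open>x\<close> minus its Taylor polynomial. If the Caputo equation holds, then
  \<open>I\<^sup>3\<^sup>-\<^sup>\<alpha> R - I\<^sup>3 f\<close> has vanishing third \<open>\<psi>\<close>-derivative, so it is a quadratic polynomial in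
  \<open>\<theta>\<close>. As \<open>R = O(\<theta>\<^sup>2)\<close> at \<open>a\<close>, this polynomial is \<open>o(\<theta>\<^sup>2)\<close>, hence zero, and injectivity of
  \<open>I\<^sup>3\<^sup>-\<^sup>\<alpha>\<close> gives \<open>R = I\<^sup>\<alpha> f\<close>. The coefficient of \<open>\<theta>\<^sup>2\<close> is then determined by the
  nonlocal boundary condition, a linear equation for it with leading coefficient \<open>N\<close>.
\<close>

section \<open>The Riemann--Liouville integral based at 0\<close>

text \<open>The special case \<open>\<psi> t = t\<close> with base point 0, to which
  \<open>J_eq_RL\<close> reduces the general integral.\<close>

definition RL :: "real \<Rightarrow> (real \<Rightarrow> real) \<Rightarrow> real \<Rightarrow> real" where
  "RL p y t = 1 / Gamma p * integral {0..t} (\<lambda>s. (t - s) powr (p - 1) * y s)"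

text \<open>The substitution s = t * u turns this into Euler's Beta integral over [0,1]. The
  conditions on p and r give convergence at s = t and s = 0 respectively.\<close>

lemma has_integral_kernel_powr:
  fixes p r t :: real
  assumes "p > 0" "r > -1" "t \<ge> 0"
  shows "((\<lambda>s. (t - s) powr (p - 1) * s powr r) has_integral (Beta p (r + 1) * t powr (p + r))) {0..t}"
proof (cases "t = 0")
  case True
  \<comment> \<open>Since \<open>0 powr z\<close> is 0 for every z, the claimed value is 0 even when
    p + r is not positive.\<close>
  then show ?thesis using has_integral_refl(2)[of _ "0::real"] by simp
next
  case False
  with assms have t: "t > 0" by simp
  have "((\<lambda>u. u powr r * (1 - u) powr (p - 1)) has_integral Beta (r + 1) p) {0..1}"
    using has_integral_Beta_real[of "r + 1" p] assms by simp
  from has_integral_stretch_real[OF this, of "1 / t"] t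
  have "((\<lambda>s. (1 / t * s) powr r * (1 - 1 / t * s) powr (p - 1)) has_integral t * Beta (r + 1) p)
      ((\<lambda>x. x / (1 / t)) ` {0..1})"
    by simp
  also have "(\<lambda>x. x / (1 / t)) ` {0..1} = {0..t}"
    using t image_mult_atLeastAtMost[of t 0 1] by (simp add: mult.commute)
  finally have "((\<lambda>s. t powr (p + r - 1) * ((1 / t * s) powr r * (1 - 1 / t * s) powr (p - 1)))
      has_integral t powr (p + r - 1) * (t * Beta (r + 1) p)) {0..t}"
    by (rule has_integral_mult_right)
  moreover have "t powr (p + r - 1) * (t * Beta (r + 1) p) = Beta p (r + 1) * t powr (p + r)"
    using t by (simp add: Beta_commute powr_diff)
  moreover have "t powr (p + r - 1) * ((1 / t * s) powr r * (1 - 1 / t * s) powr (p - 1)) =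
      (t - s) powr (p - 1) * s powr r" if "s \<in> {0..t}" for s
  proof -
    have "(1 / t * s) powr r = s powr r / t powr r"
      using that t by (simp add: powr_divide)
    moreover have "1 - 1 / t * s = (t - s) / t"
      using t by (simp add: field_simps)
    then have "(1 - 1 / t * s) powr (p - 1) = (t - s) powr (p - 1) / t powr (p - 1)"
      using that t by (simp add: powr_divide)
    moreover have "t powr (p + r - 1) = t powr r * t powr (p - 1)"
      by (simp add: powr_add[symmetric] algebra_simps)
    ultimately show ?thesis using t by simp
  qed
  ultimately show ?thesis by (metis (no_types, lifting) has_integral_cong)
qed

lemma RL_powr:
  assumes "p > 0" "r > -1" "t \<ge> 0"
  shows "RL p (\<lambda>s. s powr r) t = Gamma (r + 1) / Gamma (p + r + 1) * t powr (p + r)"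
proof -
  have "Gamma p \<noteq> 0" using Gamma_real_pos[OF assms(1)] by linarith
  then show ?thesis
    unfolding RL_def integral_unique[OF has_integral_kernel_powr[OF assms]]
    by (simp add: Beta_def add.assoc)
qed

text \<open>The kernel is nonnegative and integrable, by the Beta integral with r = 0; a continuous
  factor on a compact interval is bounded and measurable, so the product stays absolutely
  integrable.\<close>

lemma absolutely_integrable_kernel_mult:
  fixes p t :: real and y :: "real \<Rightarrow> real"
  assumes "p > 0" "continuous_on {0..t} y"
  shows "(\<lambda>s. (t - s) powr (p - 1) * y s) absolutely_integrable_on {0..t}"
proof (cases "t \<ge> 0")
  case True
  have "(\<lambda>s. (t - s) powr (p - 1) * s powr 0) integrable_on {0..t}"
    using has_integral_kernel_powr[of p 0 t] assms True by (auto simp: integrable_on_def)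
  \<comment> \<open>\<open>s powr 0\<close> is 1 except at s = 0, where it is 0; hence the
    exceptional null set.\<close>
  then have "(\<lambda>s. (t - s) powr (p - 1)) integrable_on {0..t}"
    by (rule integrable_spike[where S = "{0}"]) auto
  then have k: "(\<lambda>s. (t - s) powr (p - 1)) absolutely_integrable_on {0..t}"
    by (rule nonnegative_absolutely_integrable_1) simp
  have "(\<lambda>s. y s * (t - s) powr (p - 1)) absolutely_integrable_on {0..t}"
    using assms k
    by (intro absolutely_integrable_bounded_measurable_product_real continuous_imp_measurable_on_sets_lebesgue
        compact_imp_bounded compact_continuous_image) auto
  then show ?thesis by (simp add: mult.commute)
qed auto

lemma integrable_kernel_mult:
  fixes p t :: real and y :: "real \<Rightarrow> real"
  assumes "p > 0" "continuous_on {0..t} y"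
  shows "(\<lambda>s. (t - s) powr (p - 1) * y s) integrable_on {0..t}"
  using absolutely_integrable_kernel_mult[OF assms] set_lebesgue_integral_eq_integral(1) by blast

section \<open>Congruence, linearity and values on monomials\<close>

lemma RL_cong:
  assumes "\<And>s. s \<in> {0..t} \<Longrightarrow> y s = z s"
  shows "RL p y t = RL p z t"
  unfolding RL_def using assms by (auto intro!: integral_cong)

text \<open>A single point is negligible. This lets \<open>s ^ k\<close> be exchanged for
  \<open>s powr k\<close>, which differ at s = 0 when k = 0.\<close>

lemma RL_cong_Ioc:
  assumes "\<And>s. s \<in> {0<..t} \<Longrightarrow> y s = z s"
  shows "RL p y t = RL p z t"
  unfolding RL_def using assms
  by (intro arg_cong[where f = "\<lambda>u. _ * u"] integral_spike[where S = "{0}"]) auto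

lemma RL_cmult: "RL p (\<lambda>s. c * y s) t = c * RL p y t"
  unfolding RL_def using integral_mult_right[of "{0..t}" c "\<lambda>s. (t - s) powr (p - 1) * y s"]
  by (simp add: mult.left_commute)

lemma RL_add:
  assumes "p > 0" "continuous_on {0..t} y" "continuous_on {0..t} z"
  shows "RL p (\<lambda>s. y s + z s) t = RL p y t + RL p z t"
  unfolding RL_def
  using integral_add[OF integrable_kernel_mult[OF assms(1,2)] integrable_kernel_mult[OF assms(1,3)]]
  by (simp add: distrib_left)

lemma RL_diff:
  assumes "p > 0" "continuous_on {0..t} y" "continuous_on {0..t} z"
  shows "RL p (\<lambda>s. y s - z s) t = RL p y t - RL p z t"
  using RL_add[OF assms(1,2), of "\<lambda>s. (-1) * z s"] assms(3) RL_cmult[of p "-1" z t]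
  by (simp add: continuous_on_minus)

lemma RL_sum:
  assumes "p > 0" "finite I" "\<And>i. i \<in> I \<Longrightarrow> continuous_on {0..t} (y i)"
  shows "RL p (\<lambda>s. \<Sum>i\<in>I. c i * y i s) t = (\<Sum>i\<in>I. c i * RL p (y i) t)"
  using assms(2,3)
proof (induction I rule: finite_induct)
  case empty
  then show ?case by (simp add: RL_def)
next
  case (insert i I)
  then show ?case using assms(1)
    by (simp add: RL_add RL_cmult continuous_intros)
qed

lemma RL_power:
  assumes "p > 0" "t \<ge> 0"
  shows "RL p (\<lambda>s. s ^ k) t = fact k / Gamma (p + real k + 1) * t powr (p + real k)"
proof -
  have "RL p (\<lambda>s. s ^ k) t = RL p (\<lambda>s. s powr real k) t"
    by (rule RL_cong_Ioc) (simp add: powr_realpow)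
  with assms show ?thesis by (simp add: RL_powr Gamma_fact add.commute)
qed

section \<open>Sup-norm estimate, continuity and the semigroup law\<close>

lemma abs_RL_le:
  assumes "p > 0" "t \<ge> 0" "continuous_on {0..t} y" "\<And>s. s \<in> {0..t} \<Longrightarrow> \<bar>y s\<bar> \<le> M"
  shows "\<bar>RL p y t\<bar> \<le> M * t powr p / Gamma (p + 1)"
proof -
  have "norm (integral {0..t} (\<lambda>s. (t - s) powr (p - 1) * y s))
      \<le> integral {0..t} (\<lambda>s. (t - s) powr (p - 1) * M)"
    by (intro Henstock_Kurzweil_Integration.integral_norm_bound_integral integrable_kernel_mult assms continuous_intros)
      (use assms in \<open>auto simp: abs_mult intro!: mult_left_mono\<close>)
  \<comment> \<open>The constant is written with \<open>s ^ 0\<close> so that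
    \<open>RL_power\<close> evaluates the bound.\<close>
  then have "\<bar>RL p y t\<bar> \<le> RL p (\<lambda>s. M * s ^ 0) t"
    using assms(1) Gamma_real_pos[of p] by (simp add: RL_def abs_mult divide_right_mono)
  also have "\<dots> = M * t powr p / Gamma (p + 1)"
    using assms(1,2) unfolding RL_cmult RL_power[OF assms(1,2)] by simp
  finally show ?thesis .
qed

text \<open>By Weierstrass, y is a uniform limit of polynomials. \<open>RL p\<close> sends
  polynomials to sums of continuous powers and is bounded in the sup norm, so \<open>RL p y\<close>
  is a uniform limit of continuous functions.\<close>

lemma continuous_on_RL:
  assumes "p > 0" "c \<ge> 0" "continuous_on {0..c} y"
  shows "continuous_on {0..c} (RL p y)"
proof -
  have "\<exists>g. continuous_on {0..c} g \<and> (\<forall>t\<in>{0..c}. \<bar>RL p y t - g t\<bar> < e)" if "e > 0" for e :: real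
  proof -
    \<comment> \<open>A exceeds the sup-norm bound of \<open>RL p\<close> on [0,c]; the added 1
      makes the final estimate strict and A positive. Approximating y within e / A then
      suffices.\<close>
    define A where "A = c powr p / Gamma (p + 1) + 1"
    have A: "A > 0" using assms(1) Gamma_real_pos[of "p + 1"] by (simp add: A_def add_nonneg_pos)
    define d where "d = e / A"
    have d: "d > 0" using that A by (simp add: d_def)
    obtain g where g: "real_polynomial_function g" "\<And>s. s \<in> {0..c} \<Longrightarrow> \<bar>y s - g s\<bar> < d"
      using Stone_Weierstrass_real_polynomial_function[OF _ assms(3) d] by auto
    obtain q n where q: "g = (\<lambda>s. \<Sum>i\<le>n. q i * s ^ i)"
      using g(1) unfolding real_polynomial_function_iff_sum by blast
    have cg: "continuous_on S g" for S unfolding q by (intro continuous_intros)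
    have *: "RL p g t = (\<Sum>i\<le>n. q i * (fact i / Gamma (p + real i + 1) * t powr (p + real i)))"
      if "t \<in> {0..c}" for t
      using that assms(1) unfolding q by (subst RL_sum) (auto simp: RL_power intro!: continuous_intros)
    \<comment> \<open>The exponents p + i are positive, so each power is continuous at 0 as
      well.\<close>
    have "continuous_on {0..c} (\<lambda>t. \<Sum>i\<le>n. q i * (fact i / Gamma (p + real i + 1) * t powr (p + real i)))"
      using assms(1) by (intro continuous_intros continuous_on_powr') (auto simp: add_pos_nonneg)
    then have "continuous_on {0..c} (RL p g)"
      by (rule continuous_on_eq) (simp add: *)
    moreover have "\<bar>RL p y t - RL p g t\<bar> < e" if t: "t \<in> {0..c}" for t
    proof -
      have cy: "continuous_on {0..t} y" using assms(3) t by (auto intro: continuous_on_subset)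
      have "\<bar>RL p (\<lambda>s. y s - g s) t\<bar> \<le> d * t powr p / Gamma (p + 1)"
        using t g(2) by (intro abs_RL_le assms continuous_intros cy cg) (auto intro: less_imp_le)
      also have "\<dots> \<le> d * c powr p / Gamma (p + 1)"
        using t d assms(1) Gamma_real_pos[of "p + 1"] by (intro divide_right_mono mult_left_mono powr_mono2) auto
      also have "\<dots> < d * A" using d by (simp add: A_def algebra_simps)
      also have "\<dots> = e" using A by (simp add: d_def)
      finally show ?thesis using RL_diff[OF assms(1) cy cg] by simp
    qed
    ultimately show ?thesis by blast
  qed
  then have "\<exists>g. continuous_on {0..c} g \<and> (\<forall>t\<in>{0..c}. \<bar>RL p y t - g t\<bar> < inverse (real (Suc n)))" for n
    by simp
  then obtain g where g: "\<And>n. continuous_on {0..c} (g n)"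
      "\<And>n t. t \<in> {0..c} \<Longrightarrow> \<bar>RL p y t - g n t\<bar> < inverse (real (Suc n))"
    by metis
  show ?thesis
  proof (rule uniform_limit_theorem[where F = sequentially and f = g])
    show "uniform_limit {0..c} g (RL p y) sequentially"
    proof (rule uniform_limitI)
      fix e :: real assume "e > 0"
      then have "\<forall>\<^sub>F n in sequentially. inverse (real (Suc n)) < e"
        using LIMSEQ_inverse_real_of_nat by (rule order_tendstoD(2)[rotated])
      then show "\<forall>\<^sub>F n in sequentially. \<forall>t\<in>{0..c}. dist (g n t) (RL p y t) < e"
        by eventually_elim (unfold dist_real_def, metis g(2) abs_minus_commute less_trans)
    qed
  qed (use g in auto)
qed

text \<open>Apply the power rule twice; the intermediate factor
  \<open>Gamma (q + real k + 1)\<close> cancels.\<close>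

lemma RL_RL_power:
  assumes "p > 0" "q > 0" "t \<ge> 0"
  shows "RL p (RL q (\<lambda>s. s ^ k)) t = RL (p + q) (\<lambda>s. s ^ k) t"
proof -
  have "Gamma (q + real k + 1) > 0" using assms by (intro Gamma_real_pos) simp
  then have "Gamma (1 + (q + real k)) \<noteq> 0" by (simp add: add_ac)
  moreover have "RL p (RL q (\<lambda>s. s ^ k)) t =
      RL p (\<lambda>s. fact k / Gamma (q + real k + 1) * s powr (q + real k)) t"
    by (rule RL_cong) (use assms in \<open>simp add: RL_power\<close>)
  ultimately show ?thesis
    using assms unfolding RL_cmult by (simp add: RL_powr RL_power add_ac)
qed

text \<open>Both sides are linear in y, bounded in the sup norm, and equal on polynomials by
  \<open>RL_RL_power\<close>; density of polynomials gives the rest.\<close>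

lemma RL_RL:
  assumes "p > 0" "q > 0" "t \<in> {0..c}" "continuous_on {0..c} y"
  shows "RL p (RL q y) t = RL (p + q) y t"
proof -
  have t: "t \<ge> 0" and cy: "continuous_on {0..t} y"
    using assms(3,4) by (auto intro: continuous_on_subset)
  \<comment> \<open>The sum of the sup-norm bounds for the two sides: \<open>abs_RL_le\<close> used
    twice for the composition and once for order p + q.\<close>
  define A where "A = t powr q / Gamma (q + 1) * t powr p / Gamma (p + 1) + t powr (p + q) / Gamma (p + q + 1)"
  have "\<bar>RL p (RL q y) t - RL (p + q) y t\<bar> \<le> e * A" if e: "e > 0" for e
  proof -
    obtain g where g: "real_polynomial_function g" "\<And>s. s \<in> {0..t} \<Longrightarrow> \<bar>y s - g s\<bar> < e"
      using Stone_Weierstrass_real_polynomial_function[OF _ cy e] by auto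
    obtain a n where a: "g = (\<lambda>s. \<Sum>i\<le>n. a i * s ^ i)"
      using g(1) unfolding real_polynomial_function_iff_sum by blast
    have cg: "continuous_on S g" for S unfolding a by (intro continuous_intros)
    have cd: "continuous_on {0..u} (\<lambda>s. y s - g s)" if "u \<le> t" for u
      using that by (intro continuous_intros continuous_on_subset[OF cy] cg) auto
    have g0: "RL q g s = (\<Sum>i\<le>n. a i * RL q (\<lambda>s. s ^ i) s)" for s
      unfolding a using assms(2) by (intro RL_sum continuous_intros) auto
    have gg: "RL p (RL q g) t = RL (p + q) g t"
    proof -
      have "RL p (RL q g) t = (\<Sum>i\<le>n. a i * RL p (RL q (\<lambda>s. s ^ i)) t)"
        unfolding g0[abs_def] using assms(1,2) t by (intro RL_sum continuous_on_RL continuous_intros) auto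
      also have "\<dots> = (\<Sum>i\<le>n. a i * RL (p + q) (\<lambda>s. s ^ i) t)"
        using assms(1,2) t by (simp add: RL_RL_power)
      also have "\<dots> = RL (p + q) g t"
        unfolding a using assms(1,2) by (intro RL_sum[symmetric] continuous_intros) auto
      finally show ?thesis .
    qed
    have "RL p (RL q (\<lambda>s. y s - g s)) t = RL p (\<lambda>s. RL q y s - RL q g s) t"
      using assms(2) by (intro RL_cong RL_diff continuous_on_subset[OF cy] cg) auto
    also have "\<dots> = RL p (RL q y) t - RL p (RL q g) t"
      using assms(1,2) t cy by (intro RL_diff continuous_on_RL cg)
    finally have 1: "RL p (RL q (\<lambda>s. y s - g s)) t = RL p (RL q y) t - RL (p + q) g t"
      using gg by simp
    have 2: "RL (p + q) (\<lambda>s. y s - g s) t = RL (p + q) y t - RL (p + q) g t"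
      using assms(1,2) cy by (intro RL_diff cg) auto
    have "\<bar>RL q (\<lambda>s. y s - g s) u\<bar> \<le> e * t powr q / Gamma (q + 1)" if u: "u \<in> {0..t}" for u
    proof -
      have "\<bar>RL q (\<lambda>s. y s - g s) u\<bar> \<le> e * u powr q / Gamma (q + 1)"
        using u g(2) by (intro abs_RL_le assms cd) (auto intro: less_imp_le)
      also have "\<dots> \<le> e * t powr q / Gamma (q + 1)"
        using u e assms(2) Gamma_real_pos[of "q + 1"] by (intro divide_right_mono mult_left_mono powr_mono2) auto
      finally show ?thesis .
    qed
    then have 3: "\<bar>RL p (RL q (\<lambda>s. y s - g s)) t\<bar>
        \<le> (e * t powr q / Gamma (q + 1)) * t powr p / Gamma (p + 1)"
      using assms(1,2) t cd[of t] by (intro abs_RL_le continuous_on_RL) auto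
    have 4: "\<bar>RL (p + q) (\<lambda>s. y s - g s) t\<bar> \<le> e * t powr (p + q) / Gamma (p + q + 1)"
      using assms(1,2) t cd[of t] g(2) by (intro abs_RL_le) (auto intro: less_imp_le)
    have "e * A = (e * t powr q / Gamma (q + 1)) * t powr p / Gamma (p + 1)
        + e * t powr (p + q) / Gamma (p + q + 1)"
      by (simp add: A_def distrib_left)
    then show ?thesis using 1 2 3 4 by linarith
  qed
  \<comment> \<open>A does not depend on e, so e may tend to 0.\<close>
  then have "\<forall>\<^sub>F e in at_right 0. \<bar>RL p (RL q y) t - RL (p + q) y t\<bar> \<le> e * A"
    by (auto simp: eventually_at_right_less eventually_at_filter)
  moreover have "((\<lambda>e. e * A) \<longlongrightarrow> 0 * A) (at_right 0)" by (intro tendsto_intros)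
  ultimately have "\<bar>RL p (RL q y) t - RL (p + q) y t\<bar> \<le> 0 * A"
    by (intro tendsto_lowerbound) auto
  then show ?thesis by simp
qed

section \<open>Differentiation and injectivity\<close>

lemma RL_1: "RL 1 y t = integral {0..t} y"
  unfolding RL_def by (simp, rule integral_spike[where S = "{t}"]) auto

lemma RL_1_has_derivative:
  assumes "continuous_on {0..c} y" "t \<in> {0..c}"
  shows "(RL 1 y has_real_derivative y t) (at t within {0..c})"
  using integral_has_real_derivative[OF assms] by (simp add: RL_1[abs_def])

text \<open>The semigroup law writes I^(p+1) as I^1 I^p, and the fundamental theorem of calculus
  applies to the continuous function \<open>RL p y\<close>.\<close>

lemma RL_Suc_has_derivative:
  assumes "p > 0" "continuous_on {0..c} y" "t \<in> {0..c}"
  shows "(RL (p + 1) y has_real_derivative RL p y t) (at t within {0..c})"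
proof -
  have "(RL 1 (RL p y) has_real_derivative RL p y t) (at t within {0..c})"
    using assms by (intro RL_1_has_derivative continuous_on_RL) auto
  then show ?thesis
    by (rule has_field_derivative_transform_within[OF _ zero_less_one assms(3)])
      (use assms RL_RL[of 1 p _ c y] in \<open>simp add: add.commute\<close>)
qed

text \<open>Applying I^(1-p) to I^p y = 0 gives I^1 y = 0, and differentiating recovers y.\<close>

lemma RL_eq_0_imp_eq_0:
  assumes "0 < p" "p < 1" "continuous_on {0..c} y" "\<And>s. s \<in> {0..c} \<Longrightarrow> RL p y s = 0"
    and "t \<in> {0..c}" "c > 0"
  shows "y t = 0"
proof -
  have "RL 1 y s = 0" if "s \<in> {0..c}" for s
  proof -
    have "RL 1 y s = RL (1 - p) (RL p y) s"
      using RL_RL[OF _ _ that assms(3), of "1 - p" p] assms(1,2) by simp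
    also have "\<dots> = RL (1 - p) (\<lambda>_. 0) s"
      using that by (intro RL_cong assms(4)) auto
    finally show ?thesis by (simp add: RL_def)
  qed
  then have "((\<lambda>_. 0) has_real_derivative y t) (at t within {0..c})"
    by (intro has_field_derivative_transform_within[OF RL_1_has_derivative[OF assms(3,5)] zero_less_one assms(5)])
  moreover have "((\<lambda>_. 0::real) has_real_derivative 0) (at t within {0..c})" by simp
  \<comment> \<open>As c > 0, t is a limit point of [0,c], so the derivative within this interval is
    unique.\<close>
  ultimately show ?thesis
    using vector_derivative_unique_within[of t "{0..c}"] assms(5,6)
    by (metis has_real_derivative_iff_has_vector_derivative islimpt_Icc trivial_limit_within)
qed

section \<open>Elementary calculus\<close>

lemma deriv_on_eqI:
  assumes "a < b" "t \<in> {a..b}" "(g has_real_derivative d) (at t within {a..b})"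
  shows "deriv_on a b g t = d"
  using assms vector_derivative_within_cbox[of a b t g d]
  by (simp add: deriv_on_def has_real_derivative_iff_has_vector_derivative)

lemma has_real_derivative_deriv_on:
  assumes "g differentiable (at t within {a..b})"
  shows "(g has_real_derivative deriv_on a b g t) (at t within {a..b})"
  using assms unfolding deriv_on_def
  by (simp add: has_real_derivative_iff_has_vector_derivative vector_derivative_works)

lemma nondecreasing_if_derivative_nonneg:
  fixes h :: "real \<Rightarrow> real"
  assumes "\<And>t. t \<in> {u..v} \<Longrightarrow> (h has_real_derivative h' t) (at t within {a..b})"
    and "\<And>t. t \<in> {u..v} \<Longrightarrow> 0 \<le> h' t" and "u \<le> v" "{u..v} \<subseteq> {a..b}"
  shows "h u \<le> h v"
proof -
  have "\<exists>x\<in>{u..v}. h v - h u = h' x * (v - u)"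
  proof (rule mvt_very_simple[OF assms(3)])
    fix x assume "u \<le> x" "x \<le> v"
    then show "(h has_derivative (*) (h' x)) (at x within {u..v})"
      using DERIV_subset[OF assms(1,4)] by (simp add: has_field_derivative_def)
  qed
  then show ?thesis using assms(2,3) by (metis diff_ge_0_iff_ge mult_nonneg_nonneg)
qed

text \<open>Let s tend to 0 from the right, after dividing by 1, s and s^2 in turn. Since q > 2, the
  bound still vanishes in the limit after the last division.\<close>

lemma quadratic_eq_0_if_small:
  fixes c0 c1 c2 A B q d :: real
  assumes "q > 2" "d > 0"
    and le: "\<And>s. 0 < s \<Longrightarrow> s < d \<Longrightarrow> \<bar>c0 + c1 * s + c2 * s\<^sup>2\<bar> \<le> A * s powr q + B * s ^ 3"
  shows "c0 = 0" "c1 = 0" "c2 = 0"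
proof -
  have ev: "\<forall>\<^sub>F s in at_right 0. 0 < s \<and> s < d"
    using assms(2) by (intro eventually_conj) (auto simp: eventually_at_right_less intro: eventually_at_rightI)
  have zero: "u 0 = 0" if u: "isCont u 0"
    and ul: "\<And>s. 0 < s \<Longrightarrow> s < d \<Longrightarrow> \<bar>u s\<bar> \<le> A * s powr r + B * s ^ k" and "r > 0" "k > 0"
    for u :: "real \<Rightarrow> real" and r :: real and k :: nat
  proof -
    have "((\<lambda>s. \<bar>u s\<bar>) \<longlongrightarrow> \<bar>u 0\<bar>) (at_right 0)"
      using u unfolding isCont_def by (intro tendsto_rabs) (rule tendsto_within_subset[OF _ subset_UNIV])
    moreover have "((\<lambda>s. s powr r) \<longlongrightarrow> 0) (at_right 0)"
      using that(3) by (intro tendsto_zero_powrI[where b = r] tendsto_intros) (auto simp: eventually_at_right_less eventually_at_filter)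
    then have "((\<lambda>s. A * s powr r + B * s ^ k) \<longlongrightarrow> A * 0 + B * 0 ^ k) (at_right 0)"
      by (intro tendsto_intros)
    moreover have "\<forall>\<^sub>F s in at_right 0. \<bar>u s\<bar> \<le> A * s powr r + B * s ^ k"
      using ev by eventually_elim (use ul in auto)
    ultimately have "\<bar>u 0\<bar> \<le> A * 0 + B * 0 ^ k"
      by (intro tendsto_le[OF trivial_limit_at_right_real])
    then show ?thesis using that(4) by (simp add: zero_power)
  qed
  show c0: "c0 = 0"
    using zero[of "\<lambda>s. c0 + c1 * s + c2 * s\<^sup>2" q 3] le assms(1) by simp
  have "\<bar>c1 + c2 * s\<bar> \<le> A * s powr (q - 1) + B * s ^ 2" if "0 < s" "s < d" for s
  proof -
    have "\<bar>c1 + c2 * s\<bar> * s = \<bar>c0 + c1 * s + c2 * s\<^sup>2\<bar>"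
    proof -
      have "c0 + c1 * s + c2 * s\<^sup>2 = (c1 + c2 * s) * s"
        using c0 by (simp add: algebra_simps power2_eq_square)
      then show ?thesis using that(1) by (simp add: abs_mult)
    qed
    also have "\<dots> \<le> A * s powr q + B * s ^ 3" by (rule le[OF that])
    also have "\<dots> = (A * s powr (q - 1) + B * s ^ 2) * s"
      using that(1) by (simp add: powr_diff field_simps power2_eq_square power3_eq_cube)
    finally show ?thesis using that(1) by simp
  qed
  from zero[of "\<lambda>s. c1 + c2 * s", OF _ this] assms(1) show c1: "c1 = 0" by simp
  have "\<bar>c2\<bar> \<le> A * s powr (q - 2) + B * s ^ 1" if "0 < s" "s < d" for s
  proof -
    have "\<bar>c2\<bar> * s\<^sup>2 = \<bar>c0 + c1 * s + c2 * s\<^sup>2\<bar>"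
      using c0 c1 by (simp add: abs_mult)
    also have "\<dots> \<le> A * s powr q + B * s ^ 3" by (rule le[OF that])
    also have "\<dots> = (A * s powr (q - 2) + B * s ^ 1) * s\<^sup>2"
      using that(1) by (simp add: powr_diff field_simps power2_eq_square power3_eq_cube powr_numeral)
    finally show ?thesis using that(1) by simp
  qed
  from zero[of "\<lambda>s. c2", OF _ this] assms(1) show "c2 = 0" by simp
qed

lemma frac_order_eq_3: "2 < \<alpha> \<Longrightarrow> \<alpha> < 3 \<Longrightarrow> frac_order \<alpha> = 3"
proof -
  assume "2 < \<alpha>" "\<alpha> < 3"
  then have "\<lfloor>\<alpha>\<rfloor> = 2" by (intro floor_unique) auto
  then show ?thesis by (simp add: frac_order_def)
qed

section \<open>Integration and differentiation with respect to a scale function\<close>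

locale scale_function =
  fixes a b :: real and \<psi> :: "real \<Rightarrow> real"
  assumes ab: "a < b"
    and mono_psi: "mono_on {a..b} \<psi>"
    and diff_psi: "\<psi> differentiable_on {a..b}"
    and deriv_psi_nonzero: "\<forall>t\<in>{a..b}. deriv_on a b \<psi> t \<noteq> 0"
begin

section \<open>The coordinate \<theta> and its monotonicity\<close>

abbreviation \<psi>' :: "real \<Rightarrow> real" where "\<psi>' \<equiv> deriv_on a b \<psi>"

definition \<theta> :: "real \<Rightarrow> real" where "\<theta> t = \<psi> t - \<psi> a"

lemma theta_a [simp]: "\<theta> a = 0"
  by (simp add: \<theta>_def)

lemma psi_has_derivative: "t \<in> {a..b} \<Longrightarrow> (\<psi> has_real_derivative \<psi>' t) (at t within {a..b})"
  using diff_psi by (simp add: has_real_derivative_deriv_on differentiable_on_def)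

text \<open>A negative derivative would force strict decrease next to t, contradicting monotonicity.
  The comparison point lies to the right of t if t < b, and to the left if t = b.\<close>

lemma psi'_pos:
  assumes t: "t \<in> {a..b}"
  shows "\<psi>' t > 0"
proof (rule ccontr)
  assume "\<not> ?thesis"
  then have neg: "\<psi>' t < 0" using deriv_psi_nonzero t by force
  show False
  proof (cases "t < b")
    case True
    obtain d where d: "d > 0" "\<And>h. h > 0 \<Longrightarrow> t + h \<in> {a..b} \<Longrightarrow> h < d \<Longrightarrow> \<psi> (t + h) < \<psi> t"
      using has_real_derivative_neg_dec_right[OF psi_has_derivative[OF t] neg] by blast
    \<comment> \<open>Small enough for the local decrease and for t + h to remain in [a,b].\<close>
    define h where "h = min (d / 2) (b - t)"
    have "h > 0" "t + h \<in> {a..b}" "h < d" using d(1) True t by (auto simp: h_def min_def)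
    then show False using d(2)[of h] mono_onD[OF mono_psi t, of "t + h"] by auto
  next
    case False
    obtain d where d: "d > 0" "\<And>h. h > 0 \<Longrightarrow> t - h \<in> {a..b} \<Longrightarrow> h < d \<Longrightarrow> \<psi> t < \<psi> (t - h)"
      using has_real_derivative_neg_dec_left[OF psi_has_derivative[OF t] neg] by blast
    define h where "h = min (d / 2) (t - a)"
    have "h > 0" "t - h \<in> {a..b}" "h < d" using d(1) False t ab by (auto simp: h_def min_def)
    then show False using d(2)[of h] mono_onD[OF mono_psi _ t, of "t - h"] by auto
  qed
qed

lemma theta_deriv: "t \<in> {a..b} \<Longrightarrow> (\<theta> has_real_derivative \<psi>' t) (at t within {a..b})"
  unfolding \<theta>_def[abs_def] using DERIV_diff[OF psi_has_derivative DERIV_const] by simp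

lemma continuous_on_theta: "continuous_on {a..b} \<theta>"
  using theta_deriv by (intro DERIV_continuous_on)

lemma theta_strict_mono:
  assumes "s \<in> {a..b}" "t \<in> {a..b}" "s < t"
  shows "\<theta> s < \<theta> t"
proof -
  have "\<exists>x\<in>{s<..<t}. \<theta> t - \<theta> s = \<psi>' x * (t - s)"
  proof (rule mvt_simple[OF assms(3)])
    fix x assume "s \<le> x" "x \<le> t"
    moreover have "{s..t} \<subseteq> {a..b}" using assms by auto
    ultimately show "(\<theta> has_derivative (*) (\<psi>' x)) (at x within {s..t})"
      using DERIV_subset[OF theta_deriv, of x "{s..t}"] by (auto simp: has_field_derivative_def)
  qed
  then obtain x where "x \<in> {s<..<t}" "\<theta> t - \<theta> s = \<psi>' x * (t - s)" by blast
  moreover from this have "\<psi>' x * (t - s) > 0"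
    using assms psi'_pos[of x] by (intro mult_pos_pos) auto
  ultimately show ?thesis by linarith
qed

lemma theta_less_iff: "s \<in> {a..b} \<Longrightarrow> t \<in> {a..b} \<Longrightarrow> \<theta> s < \<theta> t \<longleftrightarrow> s < t"
  using theta_strict_mono[of s t] theta_strict_mono[of t s] by (cases s t rule: linorder_cases) auto

lemma theta_le_iff: "s \<in> {a..b} \<Longrightarrow> t \<in> {a..b} \<Longrightarrow> \<theta> s \<le> \<theta> t \<longleftrightarrow> s \<le> t"
  using theta_less_iff[of t s] by linarith

lemma inj_on_theta: "inj_on \<theta> {a..b}"
proof (rule inj_onI)
  fix x y assume "x \<in> {a..b}" "y \<in> {a..b}" "\<theta> x = \<theta> y"
  then show "x = y" using theta_le_iff[of x y] theta_le_iff[of y x] by auto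
qed

lemma theta_nonneg: "t \<in> {a..b} \<Longrightarrow> \<theta> t \<ge> 0"
  using theta_le_iff[of a t] ab by auto

lemma theta_pos: "t \<in> {a<..b} \<Longrightarrow> \<theta> t > 0"
  using theta_less_iff[of a t] ab by auto

lemma theta_image:
  assumes "t \<in> {a..b}"
  shows "\<theta> ` {a..t} = {0..\<theta> t}"
proof
  show "\<theta> ` {a..t} \<subseteq> {0..\<theta> t}" using assms theta_le_iff theta_nonneg by auto
  show "{0..\<theta> t} \<subseteq> \<theta> ` {a..t}"
  proof
    fix u assume "u \<in> {0..\<theta> t}"
    then have "\<exists>x\<ge>a. x \<le> t \<and> \<theta> x = u"
      using assms by (intro IVT' continuous_on_subset[OF continuous_on_theta]) auto
    then show "u \<in> \<theta> ` {a..t}" by auto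
  qed
qed

section \<open>The inverse of \<theta> and the transfer of \<open>RL\<close> to the scale
  \<psi>\<close>

definition \<phi> :: "real \<Rightarrow> real" where "\<phi> = inv_into {a..b} \<theta>"

lemma phi_theta: "t \<in> {a..b} \<Longrightarrow> \<phi> (\<theta> t) = t"
  unfolding \<phi>_def by (rule inv_into_f_f[OF inj_on_theta])

lemma phi_in: "s \<in> {0..\<theta> b} \<Longrightarrow> \<phi> s \<in> {a..b}"
  unfolding \<phi>_def using theta_image[of b] ab by (intro inv_into_into) auto

lemma theta_phi: "s \<in> {0..\<theta> b} \<Longrightarrow> \<theta> (\<phi> s) = s"
  unfolding \<phi>_def using theta_image[of b] ab by (intro f_inv_into_f) auto

lemma continuous_on_comp_phi:
  assumes "continuous_on {a..b} y"
  shows "continuous_on {0..\<theta> b} (\<lambda>s. y (\<phi> s))"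
proof -
  have "continuous_on (\<theta> ` {a..b}) \<phi>"
    by (intro continuous_on_inv continuous_on_theta) (auto simp: phi_theta)
  then have "continuous_on {0..\<theta> b} \<phi>"
    using theta_image[of b] ab by simp
  then show ?thesis
    by (rule continuous_on_compose2[OF assms]) (use phi_in in blast)
qed

abbreviation J :: "real \<Rightarrow> (real \<Rightarrow> real) \<Rightarrow> real \<Rightarrow> real" where
  "J \<equiv> psi_RL_integral a b \<psi>"

text \<open>Change of variables s = \<open>\<theta> \<tau>\<close>, in the form for injective
  differentiable maps, where absolute integrability of one side is equivalent to that of the
  other.\<close>

lemma
  assumes p: "p > 0" and y: "continuous_on {a..b} y" and t: "t \<in> {a..b}"
  shows absolutely_integrable_psi_integrand:
      "psi_integrand a b \<psi> p y t absolutely_integrable_on {a..t}" (is ?I)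
    and J_eq_RL: "J p y t = RL p (\<lambda>s. y (\<phi> s)) (\<theta> t)" (is ?E)
proof -
  define k where "k = (\<lambda>s. (\<theta> t - s) powr (p - 1) * y (\<phi> s))"
  have sub: "{0..\<theta> t} \<subseteq> {0..\<theta> b}" using t theta_le_iff[of t b] by auto
  have k: "k absolutely_integrable_on (\<theta> ` {a..t})"
    unfolding k_def theta_image[OF t]
    by (intro absolutely_integrable_kernel_mult p continuous_on_subset[OF continuous_on_comp_phi[OF y] sub])
  \<comment> \<open>Positivity of \<open>\<psi>'\<close> removes the absolute value, and differences
    of \<theta> are differences of \<psi>.\<close>
  have eq: "\<bar>\<psi>' \<tau>\<bar> * k (\<theta> \<tau>) = psi_integrand a b \<psi> p y t \<tau>" if "\<tau> \<in> {a..t}" for \<tau>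
    using that t psi'_pos[of \<tau>] by (simp add: psi_integrand_def k_def phi_theta) (simp add: \<theta>_def)
  have "(\<lambda>\<tau>. \<bar>\<psi>' \<tau>\<bar> * k (\<theta> \<tau>)) absolutely_integrable_on {a..t} \<and>
      integral {a..t} (\<lambda>\<tau>. \<bar>\<psi>' \<tau>\<bar> * k (\<theta> \<tau>)) = integral (\<theta> ` {a..t}) k"
    using t k
    by (subst has_absolute_integral_change_of_variables_1')
      (auto intro!: DERIV_subset[OF theta_deriv] inj_on_subset[OF inj_on_theta])
  moreover have "integral {a..t} (\<lambda>\<tau>. \<bar>\<psi>' \<tau>\<bar> * k (\<theta> \<tau>)) = integral {a..t} (psi_integrand a b \<psi> p y t)"
    by (rule integral_cong[OF eq])
  moreover have "(\<lambda>\<tau>. \<bar>\<psi>' \<tau>\<bar> * k (\<theta> \<tau>)) absolutely_integrable_on {a..t} \<longleftrightarrow> ?I"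
    by (rule absolutely_integrable_spike_eq[OF negligible_empty]) (simp add: eq)
  ultimately show ?I ?E using theta_image[OF t] by (auto simp: psi_RL_integral_def RL_def k_def)
qed

lemma J_cong:
  assumes "\<And>s. s \<in> {a..t} \<Longrightarrow> y s = z s"
  shows "J p y t = J p z t"
  unfolding psi_RL_integral_def using assms
  by (auto intro!: integral_cong simp: psi_integrand_def)

lemma theta_in: "t \<in> {a..b} \<Longrightarrow> \<theta> t \<in> {0..\<theta> b}"
  using theta_le_iff[of t b] theta_nonneg by auto

lemma continuous_on_subinterval:
  assumes "continuous_on {a..b} y" "t \<in> {a..b}"
  shows "continuous_on {0..\<theta> t} (\<lambda>s. y (\<phi> s))"
  using continuous_on_comp_phi[OF assms(1)] theta_in[OF assms(2)] by (auto intro: continuous_on_subset)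

lemma J_add:
  assumes "p > 0" "continuous_on {a..b} y" "continuous_on {a..b} z" "t \<in> {a..b}"
  shows "J p (\<lambda>s. y s + z s) t = J p y t + J p z t"
  using assms by (simp add: J_eq_RL RL_add continuous_on_subinterval continuous_on_add)

lemma J_diff:
  assumes "p > 0" "continuous_on {a..b} y" "continuous_on {a..b} z" "t \<in> {a..b}"
  shows "J p (\<lambda>s. y s - z s) t = J p y t - J p z t"
  using assms by (simp add: J_eq_RL RL_diff continuous_on_subinterval continuous_on_diff)

lemma J_cmult: "J p (\<lambda>s. c * y s) t = c * J p y t"
  unfolding psi_RL_integral_def psi_integrand_def
  using integral_mult_right[of "{a..t}" c "\<lambda>\<tau>. \<psi>' \<tau> * (\<psi> t - \<psi> \<tau>) powr (p - 1) * y \<tau>"]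
  by (simp add: mult.left_commute)

lemma J_theta_power:
  assumes "p > 0" "t \<in> {a..b}"
  shows "J p (\<lambda>s. \<theta> s ^ k) t = fact k / Gamma (p + real k + 1) * \<theta> t powr (p + real k)"
proof -
  have "J p (\<lambda>s. \<theta> s ^ k) t = RL p (\<lambda>s. \<theta> (\<phi> s) ^ k) (\<theta> t)"
    using assms continuous_on_theta by (intro J_eq_RL continuous_intros)
  also have "\<dots> = RL p (\<lambda>s. s ^ k) (\<theta> t)"
    using theta_in[OF assms(2)] by (intro RL_cong) (simp add: theta_phi)
  finally show ?thesis using assms by (simp add: RL_power theta_nonneg)
qed

lemma J_at_a: "J p y a = 0"
  by (simp add: psi_RL_integral_def)

lemma abs_J_le:
  assumes "p > 0" "continuous_on {a..b} y" "t \<in> {a..b}" "\<And>s. s \<in> {a..t} \<Longrightarrow> \<bar>y s\<bar> \<le> M"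
  shows "\<bar>J p y t\<bar> \<le> M * \<theta> t powr p / Gamma (p + 1)"
  unfolding J_eq_RL[OF assms(1-3)]
proof (rule abs_RL_le)
  fix s assume "s \<in> {0..\<theta> t}"
  then obtain u where "u \<in> {a..t}" "s = \<theta> u" using theta_image[OF assms(3)] by blast
  then show "\<bar>y (\<phi> s)\<bar> \<le> M" using assms(3,4) phi_theta[of u] by simp
qed (use assms theta_nonneg continuous_on_subinterval in auto)

lemma continuous_on_J:
  assumes "p > 0" "continuous_on {a..b} y"
  shows "continuous_on {a..b} (J p y)"
proof -
  have "continuous_on {a..b} (\<lambda>t. RL p (\<lambda>s. y (\<phi> s)) (\<theta> t))"
    using theta_in ab
    by (intro continuous_on_compose2[OF continuous_on_RL[OF assms(1) _ continuous_on_comp_phi[OF assms(2)]] continuous_on_theta])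
      (auto intro: theta_nonneg)
  then show ?thesis by (rule continuous_on_eq) (simp add: assms J_eq_RL)
qed

lemma J_J:
  assumes "p > 0" "q > 0" "continuous_on {a..b} y" "t \<in> {a..b}"
  shows "J p (J q y) t = J (p + q) y t"
proof -
  have "J p (J q y) t = RL p (\<lambda>s. J q y (\<phi> s)) (\<theta> t)"
    using assms continuous_on_J by (intro J_eq_RL) auto
  also have "\<dots> = RL p (RL q (\<lambda>s. y (\<phi> s))) (\<theta> t)"
  proof (rule RL_cong)
    fix s assume "s \<in> {0..\<theta> t}"
    then have s: "s \<in> {0..\<theta> b}" using theta_in[OF assms(4)] by simp
    show "J q y (\<phi> s) = RL q (\<lambda>s. y (\<phi> s)) s"
      using J_eq_RL[OF assms(2,3) phi_in[OF s]] theta_phi[OF s] by simp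
  qed
  also have "\<dots> = RL (p + q) (\<lambda>s. y (\<phi> s)) (\<theta> t)"
    using assms by (intro RL_RL[OF _ _ theta_in continuous_on_comp_phi]) auto
  finally show ?thesis using assms by (simp add: J_eq_RL)
qed

lemma J_eq_0_imp_eq_0:
  assumes "0 < p" "p < 1" "continuous_on {a..b} y" "\<And>s. s \<in> {a..b} \<Longrightarrow> J p y s = 0" "t \<in> {a..b}"
  shows "y t = 0"
proof -
  have "y (\<phi> (\<theta> t)) = 0"
  proof (rule RL_eq_0_imp_eq_0[OF assms(1,2) continuous_on_comp_phi[OF assms(3)] _ theta_in[OF assms(5)]])
    fix s assume s: "s \<in> {0..\<theta> b}"
    then show "RL p (\<lambda>s. y (\<phi> s)) s = 0"
      using assms(4)[OF phi_in[OF s]] J_eq_RL[OF assms(1,3) phi_in[OF s]] theta_phi[OF s] by simp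
  qed (use theta_pos[of b] ab in auto)
  then show ?thesis using phi_theta[OF assms(5)] by simp
qed

text \<open>Differentiability on all of [a,b] and the value of (1/\<psi>') d/dt in one relation; the
  product form avoids dividing by \<open>\<psi>'\<close>.\<close>

definition has_psi_deriv :: "(real \<Rightarrow> real) \<Rightarrow> (real \<Rightarrow> real) \<Rightarrow> bool" where
  "has_psi_deriv g g' \<longleftrightarrow>
     (\<forall>t\<in>{a..b}. (g has_real_derivative \<psi>' t * g' t) (at t within {a..b}))"

lemma has_psi_derivD:
  "has_psi_deriv g g' \<Longrightarrow> t \<in> {a..b} \<Longrightarrow> (g has_real_derivative \<psi>' t * g' t) (at t within {a..b})"
  by (simp add: has_psi_deriv_def)

lemma has_psi_deriv_cong:
  assumes "has_psi_deriv g g'" "\<And>t. t \<in> {a..b} \<Longrightarrow> h t = g t" "\<And>t. t \<in> {a..b} \<Longrightarrow> h' t = g' t"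
  shows "has_psi_deriv h h'"
  unfolding has_psi_deriv_def
proof
  fix t assume t: "t \<in> {a..b}"
  show "(h has_real_derivative \<psi>' t * h' t) (at t within {a..b})"
    using has_field_derivative_transform_within[OF has_psi_derivD[OF assms(1) t] zero_less_one t, of h] assms(3)[OF t]
    by (simp add: assms(2))
qed

text \<open>By the chain rule, the \<psi>-derivative is ordinary differentiation in the variable
  \<theta>.\<close>

lemma has_psi_deriv_comp_theta:
  assumes "\<And>s. s \<in> {0..\<theta> b} \<Longrightarrow> (G has_real_derivative G' s) (at s within {0..\<theta> b})"
  shows "has_psi_deriv (\<lambda>t. G (\<theta> t)) (\<lambda>t. G' (\<theta> t))"
  unfolding has_psi_deriv_def
proof
  fix t assume t: "t \<in> {a..b}"
  have "(G has_real_derivative G' (\<theta> t)) (at (\<theta> t) within \<theta> ` {a..b})"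
    using assms theta_in[OF t] theta_image[of b] ab by simp
  from DERIV_image_chain[OF this theta_deriv[OF t]]
  show "((\<lambda>t. G (\<theta> t)) has_real_derivative \<psi>' t * G' (\<theta> t)) (at t within {a..b})"
    by (simp add: o_def mult.commute)
qed

lemma has_psi_deriv_J_1:
  assumes "continuous_on {a..b} y"
  shows "has_psi_deriv (J 1 y) y"
  by (rule has_psi_deriv_cong[OF has_psi_deriv_comp_theta[OF RL_1_has_derivative[OF continuous_on_comp_phi[OF assms]]]])
    (auto simp: assms J_eq_RL phi_theta)

lemma has_psi_deriv_J_Suc:
  assumes "p > 0" "continuous_on {a..b} y"
  shows "has_psi_deriv (J (p + 1) y) (J p y)"
  by (rule has_psi_deriv_cong[OF has_psi_deriv_comp_theta[OF RL_Suc_has_derivative[OF assms(1) continuous_on_comp_phi[OF assms(2)]]]])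
    (use assms in \<open>auto simp: J_eq_RL\<close>)

lemma has_psi_deriv_add_quadratic:
  assumes "has_psi_deriv g g'"
  shows "has_psi_deriv (\<lambda>t. g t + c0 + c1 * \<theta> t + c2 * (\<theta> t)\<^sup>2) (\<lambda>t. g' t + c1 + 2 * c2 * \<theta> t)"
  unfolding has_psi_deriv_def
proof
  fix t assume t: "t \<in> {a..b}"
  show "((\<lambda>t. g t + c0 + c1 * \<theta> t + c2 * (\<theta> t)\<^sup>2) has_real_derivative \<psi>' t * (g' t + c1 + 2 * c2 * \<theta> t))
      (at t within {a..b})"
    by (rule DERIV_cong[OF DERIV_add[OF DERIV_add[OF DERIV_add[OF has_psi_derivD[OF assms t] DERIV_const]
          DERIV_cmult[OF theta_deriv[OF t]]] DERIV_cmult[OF DERIV_power[OF theta_deriv[OF t]]]]])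
      (simp add: algebra_simps)
qed

lemma has_psi_deriv_diff:
  assumes "has_psi_deriv g g'" "has_psi_deriv h h'"
  shows "has_psi_deriv (\<lambda>t. g t - h t) (\<lambda>t. g' t - h' t)"
  unfolding has_psi_deriv_def right_diff_distrib
  by (intro ballI DERIV_diff has_psi_derivD assms)

text \<open>Both g and -g are nondecreasing.\<close>

lemma has_psi_deriv_0_imp_const:
  assumes "has_psi_deriv g g'" "\<And>t. t \<in> {a..b} \<Longrightarrow> g' t = 0" "t \<in> {a..b}"
  shows "g t = g a"
proof (rule antisym)
  have d: "(g has_real_derivative 0) (at s within {a..b})" if "s \<in> {a..t}" for s
    using has_psi_derivD[OF assms(1), of s] assms(2)[of s] that assms(3) by simp
  have d': "((\<lambda>s. - g s) has_real_derivative 0) (at s within {a..b})" if "s \<in> {a..t}" for s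
    using DERIV_minus[OF d[OF that]] by simp
  show "g a \<le> g t"
    by (rule nondecreasing_if_derivative_nonneg[OF d]) (use assms(3) in auto)
  show "g t \<le> g a"
    using nondecreasing_if_derivative_nonneg[OF d'] assms(3) by auto
qed

text \<open>Work down from the top: g2 is constant, hence so is g1 minus a linear term in \<theta>,
  and hence so is g0 minus a quadratic one.\<close>

lemma psi_deriv_zero3_imp_quadratic:
  assumes "has_psi_deriv g0 g1" "has_psi_deriv g1 g2" "has_psi_deriv g2 g3"
    and "\<And>t. t \<in> {a..b} \<Longrightarrow> g3 t = 0" "t \<in> {a..b}"
  shows "g0 t = g0 a + g1 a * \<theta> t + g2 a / 2 * (\<theta> t)\<^sup>2"
proof -
  have 2: "g2 s = g2 a" if "s \<in> {a..b}" for s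
    using has_psi_deriv_0_imp_const[OF assms(3,4) that] by simp
  \<comment> \<open>Zero coefficients pad the expression to the shape of
    \<open>has_psi_deriv_add_quadratic\<close>.\<close>
  have "has_psi_deriv (\<lambda>t. g1 t + 0 + (- g2 a) * \<theta> t + 0 * (\<theta> t)\<^sup>2) (\<lambda>t. g2 t + (- g2 a) + 2 * 0 * \<theta> t)"
    by (rule has_psi_deriv_add_quadratic[OF assms(2)])
  moreover have "g2 s + (- g2 a) + 2 * 0 * \<theta> s = 0" if "s \<in> {a..b}" for s
    using 2[OF that] by simp
  ultimately have 0: "g1 s + 0 + (- g2 a) * \<theta> s + 0 * (\<theta> s)\<^sup>2 = g1 a + 0 + (- g2 a) * \<theta> a + 0 * (\<theta> a)\<^sup>2"
    if "s \<in> {a..b}" for s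
    using that by (rule has_psi_deriv_0_imp_const)
  have 1: "g1 s = g1 a + g2 a * \<theta> s" if "s \<in> {a..b}" for s
    using 0[OF that] by simp
  have "has_psi_deriv (\<lambda>t. g0 t + 0 + (- g1 a) * \<theta> t + (- g2 a / 2) * (\<theta> t)\<^sup>2)
      (\<lambda>t. g1 t + (- g1 a) + 2 * (- g2 a / 2) * \<theta> t)"
    by (rule has_psi_deriv_add_quadratic[OF assms(1)])
  moreover have "g1 s + (- g1 a) + 2 * (- g2 a / 2) * \<theta> s = 0" if "s \<in> {a..b}" for s
    using 1[OF that] by simp
  ultimately have "g0 t + 0 + (- g1 a) * \<theta> t + (- g2 a / 2) * (\<theta> t)\<^sup>2 = g0 a + 0 + (- g1 a) * \<theta> a + (- g2 a / 2) * (\<theta> a)\<^sup>2"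
    using assms(5) by (rule has_psi_deriv_0_imp_const)
  then show ?thesis by simp
qed

lemma psi_deriv_eq:
  assumes "has_psi_deriv g g'" "t \<in> {a..b}"
  shows "psi_deriv a b \<psi> g t = g' t"
  using deriv_on_eqI[OF ab assms(2) has_psi_derivD[OF assms]] psi'_pos[OF assms(2)]
  by (simp add: psi_deriv_def)

text \<open>The induction runs over all points of [a,b] at once, because existence of an iterate at
  t refers to the preceding one at nearby points.\<close>

lemma psi_deriv_iterate:
  assumes "\<And>k. k < n \<Longrightarrow> has_psi_deriv (G k) (G (Suc k))" "k \<le> n" "t \<in> {a..b}"
  shows "(psi_deriv a b \<psi> ^^ k) (G 0) t = G k t" "psi_deriv_exists k a b \<psi> (G 0) t"
proof -
  have "\<forall>t\<in>{a..b}. (psi_deriv a b \<psi> ^^ k) (G 0) t = G k t \<and> psi_deriv_exists k a b \<psi> (G 0) t"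
    using assms(2)
  proof (induction k)
    case (Suc k)
    then have IH: "\<forall>t\<in>{a..b}. (psi_deriv a b \<psi> ^^ k) (G 0) t = G k t \<and> psi_deriv_exists k a b \<psi> (G 0) t"
      by simp
    have d: "has_psi_deriv ((psi_deriv a b \<psi> ^^ k) (G 0)) (G (Suc k))"
      by (rule has_psi_deriv_cong[OF assms(1)]) (use Suc IH in auto)
    show ?case
    proof
      fix t assume t: "t \<in> {a..b}"
      have "(psi_deriv a b \<psi> ^^ k) (G 0) differentiable (at t within {a..b})"
        using has_psi_derivD[OF d t] by (auto simp: real_differentiable_def)
      moreover have "\<forall>\<^sub>F s in at t within {a..b}. psi_deriv_exists k a b \<psi> (G 0) s"
        using IH by (auto simp: eventually_at_filter)
      ultimately show "(psi_deriv a b \<psi> ^^ Suc k) (G 0) t = G (Suc k) t \<and> psi_deriv_exists (Suc k) a b \<psi> (G 0) t"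
        using IH t psi_deriv_eq[OF d t] by simp
    qed
  qed auto
  then show "(psi_deriv a b \<psi> ^^ k) (G 0) t = G k t" "psi_deriv_exists k a b \<psi> (G 0) t"
    using assms(3) by auto
qed

lemma has_psi_deriv_psi_deriv:
  assumes "\<And>t. t \<in> {a..b} \<Longrightarrow> g differentiable (at t within {a..b})"
  shows "has_psi_deriv g (psi_deriv a b \<psi> g)"
  unfolding has_psi_deriv_def
proof
  fix t assume t: "t \<in> {a..b}"
  then have "\<psi>' t * psi_deriv a b \<psi> g t = deriv_on a b g t"
    using deriv_psi_nonzero by (simp add: psi_deriv_def)
  then show "(g has_real_derivative \<psi>' t * psi_deriv a b \<psi> g t) (at t within {a..b})"
    using has_real_derivative_deriv_on[OF assms[OF t]] by simp
qed

lemma psi_deriv_exists_imp_differentiable: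
  "psi_deriv_exists n a b \<psi> g t \<Longrightarrow> k < n \<Longrightarrow> (psi_deriv a b \<psi> ^^ k) g differentiable (at t within {a..b})"
  by (induction n) (auto simp: less_Suc_eq)

section \<open>The Caputo problem and the Volterra equation\<close>

text \<open>A Peano-type remainder estimate that uses the second derivative only at a. The error E
  of the linear approximation of x1 satisfies |E| \<le> \<theta> near a, so the derivatives \<psi>'
  (2 \<theta> + c E) of \<theta>^2 + c R, with c = 1 or c = -1, are nonnegative there.\<close>

lemma quadratic_remainder_le:
  assumes x: "has_psi_deriv x x1"
    and x1: "(x1 has_real_derivative \<psi>' a * x2) (at a within {a..b})"
  defines "R \<equiv> \<lambda>t. x t - (x a + x1 a * \<theta> t + x2 / 2 * (\<theta> t)\<^sup>2)"
  shows "\<exists>d>0. \<forall>t\<in>{a..b}. t < a + d \<longrightarrow> \<bar>R t\<bar> \<le> (\<theta> t)\<^sup>2"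
proof -
  have a: "a \<in> {a..b}" using ab by simp
  define E where "E = (\<lambda>t. x1 t - x1 a - x2 * \<theta> t)"
  have near: "\<exists>d>0. \<forall>t\<in>{a..b}. t < a + d \<longrightarrow> c * E t \<le> \<theta> t" for c
  proof -
    \<comment> \<open>The function vanishes at a and has derivative \<open>- \<psi>' a\<close>, so
      it is negative just to the right of a.\<close>
    have "((\<lambda>t. c * E t - \<theta> t) has_real_derivative c * (\<psi>' a * x2 - 0 - x2 * \<psi>' a) - \<psi>' a) (at a within {a..b})"
      unfolding E_def by (intro DERIV_diff DERIV_cmult x1 theta_deriv[OF a] DERIV_const)
    from has_real_derivative_neg_dec_right[OF this] obtain d where
      d: "d > 0" "\<And>h. h > 0 \<Longrightarrow> a + h \<in> {a..b} \<Longrightarrow> h < d \<Longrightarrow> c * E (a + h) - \<theta> (a + h) < c * E a - \<theta> a"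
      using psi'_pos[OF a] by (auto simp: mult.commute)
    have "c * E t \<le> \<theta> t" if "t \<in> {a..b}" "t < a + d" for t
      using d(2)[of "t - a"] that by (cases "t = a") (auto simp: E_def)
    with d(1) show ?thesis by blast
  qed
  obtain d1 where d1: "d1 > 0" "\<And>t. t \<in> {a..b} \<Longrightarrow> t < a + d1 \<Longrightarrow> 1 * E t \<le> \<theta> t"
    using near[of 1] by blast
  obtain d2 where d2: "d2 > 0" "\<And>t. t \<in> {a..b} \<Longrightarrow> t < a + d2 \<Longrightarrow> (-1) * E t \<le> \<theta> t"
    using near[of "-1"] by blast
  have sq: "0 \<le> (\<theta> t)\<^sup>2 + c * R t"
    if t: "t \<in> {a..b}" "t < a + min d1 d2" and c: "c = 1 \<or> c = -1" for t c
  proof -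
    have "(\<theta> a)\<^sup>2 + c * R a \<le> (\<theta> t)\<^sup>2 + c * R t"
    proof (rule nondecreasing_if_derivative_nonneg[where u = a and v = t])
      fix s assume s: "s \<in> {a..t}"
      then have sab: "s \<in> {a..b}" using t by simp
      have "((\<lambda>t. x t + - x a + (- x1 a) * \<theta> t + (- x2 / 2) * (\<theta> t)\<^sup>2) has_real_derivative
          \<psi>' s * (x1 s + - x1 a + 2 * (- x2 / 2) * \<theta> s)) (at s within {a..b})"
        by (rule has_psi_derivD[OF has_psi_deriv_add_quadratic[OF x] sab])
      then have "(R has_real_derivative \<psi>' s * E s) (at s within {a..b})"
        by (simp add: R_def E_def algebra_simps)
      from DERIV_add[OF DERIV_power[OF theta_deriv[OF sab], of 2] DERIV_cmult[OF this, of c]]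
      show "((\<lambda>t. (\<theta> t)\<^sup>2 + c * R t) has_real_derivative \<psi>' s * (2 * \<theta> s + c * E s)) (at s within {a..b})"
        by (simp add: algebra_simps)
      have "s < a + d1" "s < a + d2" using s t by auto
      then have "2 * \<theta> s + c * E s \<ge> 0"
        using d1(2)[OF sab] d2(2)[OF sab] theta_nonneg[OF sab] c \<open>s < a + d1\<close> \<open>s < a + d2\<close> by auto
      then show "0 \<le> \<psi>' s * (2 * \<theta> s + c * E s)"
        using psi'_pos[OF sab] by simp
    qed (use t in auto)
    then show ?thesis by (simp add: R_def)
  qed
  have "\<bar>R t\<bar> \<le> (\<theta> t)\<^sup>2" if "t \<in> {a..b}" "t < a + min d1 d2" for t
    using sq[OF that, of 1] sq[OF that, of "-1"] by simp
  then show ?thesis using d1(1) d2(1) by (intro exI[of _ "min d1 d2"]) simp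
qed

lemma psi_Taylor_3:
  "psi_Taylor a b \<psi> 3 x t =
     x a + psi_deriv a b \<psi> x a * \<theta> t + psi_deriv a b \<psi> (psi_deriv a b \<psi> x) a / 2 * (\<theta> t)\<^sup>2"
  by (simp add: psi_Taylor_def eval_nat_numeral \<theta>_def)

text \<open>The coefficient c is left open here: the initial values fix only the constant and linear
  terms, and the nonlocal condition determines c later.\<close>

lemma Caputo_imp_Volterra:
  assumes \<alpha>: "2 < \<alpha>" "\<alpha> < 3"
    and F: "continuous_on {a..b} F"
    and x: "x differentiable_on {a..b}"
    and Caputo: "\<And>t. t \<in> {a..b} \<Longrightarrow> psi_Caputo_deriv_exists a b \<psi> \<alpha> x t"
      "\<And>t. t \<in> {a..b} \<Longrightarrow> psi_Caputo_deriv a b \<psi> \<alpha> x t = F t"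
  shows "\<exists>c. \<forall>t\<in>{a..b}. x t = J \<alpha> F t + x a + psi_deriv a b \<psi> x a * \<theta> t + c * (\<theta> t)\<^sup>2"
proof -
  note [simp] = frac_order_eq_3[OF \<alpha>]
  have a: "a \<in> {a..b}" using ab by simp
  define D where "D = psi_deriv a b \<psi>"
  define R where "R = (\<lambda>t. x t - psi_Taylor a b \<psi> 3 x t)"
  define q where "q = 3 - \<alpha>"
  have q: "0 < q" "q < 1" using \<alpha> by (auto simp: q_def)
  have "continuous_on {a..b} x" using x by (rule differentiable_imp_continuous_on)
  then have R: "continuous_on {a..b} R"
    unfolding R_def psi_Taylor_3 by (intro continuous_intros continuous_on_theta)

  \<comment> \<open>By definition, the third \<psi>-derivative of Z is the Caputo derivative of
    x.\<close>
  define Z where "Z = J q R"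
  have Z: "psi_deriv_exists 3 a b \<psi> Z t" "(D ^^ 3) Z t = F t" if "t \<in> {a..b}" for t
    using Caputo[OF that]
    by (simp_all add: psi_Caputo_deriv_exists_def psi_RL_deriv_exists_def psi_Caputo_deriv_def
        psi_RL_deriv_def Z_def R_def q_def D_def)
  have Zd: "has_psi_deriv ((D ^^ k) Z) (D ((D ^^ k) Z))" if "k < 3" for k
    unfolding D_def
    by (intro has_psi_deriv_psi_deriv psi_deriv_exists_imp_differentiable[OF Z(1) that])
  \<comment> \<open>U0, U1, U2 are I^q R - I^3 F and its first two \<psi>-derivatives; the third one
    is zero.\<close>
  define U0 where "U0 = (\<lambda>t. Z t - J 3 F t)"
  define U1 where "U1 = (\<lambda>t. D Z t - J 2 F t)"
  define U2 where "U2 = (\<lambda>t. D (D Z) t - J 1 F t)"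
  have U: "U0 t = U0 a + U1 a * \<theta> t + U2 a / 2 * (\<theta> t)\<^sup>2" if "t \<in> {a..b}" for t
  proof (rule psi_deriv_zero3_imp_quadratic[OF _ _ _ _ that])
    show "has_psi_deriv U0 U1" unfolding U0_def U1_def
      using has_psi_deriv_diff[OF Zd[of 0] has_psi_deriv_J_Suc[OF _ F, of 2]] by simp
    show "has_psi_deriv U1 U2" unfolding U1_def U2_def
      using has_psi_deriv_diff[OF Zd[of 1] has_psi_deriv_J_Suc[OF _ F, of 1]] by simp
    show "has_psi_deriv U2 (\<lambda>t. D (D (D Z)) t - F t)" unfolding U2_def
      using has_psi_deriv_diff[OF Zd[of 2] has_psi_deriv_J_1[OF F]] by (simp add: numeral_2_eq_2)
    show "D (D (D Z)) s - F s = 0" if "s \<in> {a..b}" for s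
      using Z(2)[OF that] by (simp add: numeral_3_eq_3)
  qed

  \<comment> \<open>Existence of the Taylor coefficients makes \<open>D x\<close> differentiable at
    a, as the remainder estimate requires.\<close>
  have ex: "psi_deriv_exists 2 a b \<psi> x a"
    using Caputo(1)[OF a] by (auto simp: psi_Caputo_deriv_exists_def)
  have "has_psi_deriv x (D x)"
    unfolding D_def using x by (intro has_psi_deriv_psi_deriv) (simp add: differentiable_on_def)
  moreover have "(D x has_real_derivative \<psi>' a * D (D x) a) (at a within {a..b})"
    using has_real_derivative_deriv_on[OF psi_deriv_exists_imp_differentiable[OF ex, of 1]] deriv_psi_nonzero a
    by (simp add: D_def psi_deriv_def)
  ultimately obtain d where d: "d > 0" "\<And>t. t \<in> {a..b} \<Longrightarrow> t < a + d \<Longrightarrow> \<bar>R t\<bar> \<le> (\<theta> t)\<^sup>2"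
    using quadratic_remainder_le[of x "D x" "D (D x) a"] unfolding R_def psi_Taylor_3 D_def by blast
  obtain M where M: "\<And>t. t \<in> {a..b} \<Longrightarrow> \<bar>F t\<bar> \<le> M"
    using compact_imp_bounded[OF compact_continuous_image[OF F compact_Icc]] unfolding bounded_iff by force
  define t0 where "t0 = min b (a + d / 2)"
  have t0: "t0 \<in> {a<..b}" "t0 < a + d" using d(1) ab by (auto simp: t0_def min_def)
  \<comment> \<open>I^q of a function bounded by \<theta>^2 contributes the power 2 + q, and I^3 of
    the bounded function F contributes the cube.\<close>
  have small: "\<bar>U0 a + U1 a * s + U2 a / 2 * s\<^sup>2\<bar> \<le> 1 / Gamma (q + 1) * s powr (2 + q) + M / Gamma 4 * s ^ 3"
    if s: "0 < s" "s < \<theta> t0" for s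
  proof -
    obtain t where t: "t \<in> {a..t0}" "s = \<theta> t"
      using theta_image[of t0] t0(1) s by (metis atLeastAtMost_iff greaterThanAtMost_iff imageE less_imp_le)
    then have tab: "t \<in> {a..b}" using t0(1) by simp
    have "\<bar>J q R t\<bar> \<le> (\<theta> t)\<^sup>2 * \<theta> t powr q / Gamma (q + 1)"
    proof (rule abs_J_le[OF q(1) R tab])
      fix s assume s: "s \<in> {a..t}"
      then have "\<bar>R s\<bar> \<le> (\<theta> s)\<^sup>2" using d(2)[of s] t(1) t0(2) tab by simp
      also have "\<dots> \<le> (\<theta> t)\<^sup>2"
        using s tab theta_le_iff[of s t] theta_nonneg[of s] by (intro power_mono) auto
      finally show "\<bar>R s\<bar> \<le> (\<theta> t)\<^sup>2" .
    qed
    also have "(\<theta> t)\<^sup>2 * \<theta> t powr q = s powr (2 + q)"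
      using s t(2) by (simp add: powr_add powr_numeral)
    finally have 1: "\<bar>Z t\<bar> \<le> 1 / Gamma (q + 1) * s powr (2 + q)" by (simp add: Z_def)
    have "\<bar>J 3 F t\<bar> \<le> M * \<theta> t powr 3 / Gamma (3 + 1)"
      using tab M by (intro abs_J_le F) auto
    then have "\<bar>J 3 F t\<bar> \<le> M / Gamma 4 * s ^ 3"
      using s t(2) by (simp add: powr_numeral)
    moreover have "U0 a + U1 a * s + U2 a / 2 * s\<^sup>2 = Z t - J 3 F t"
      using U[OF tab] t(2) by (simp add: U0_def)
    ultimately show ?thesis using 1 by linarith
  qed
  have "2 + q > 2" "\<theta> t0 > 0" using q theta_pos[OF t0(1)] by auto
  from quadratic_eq_0_if_small[OF this small]
  have "U0 a = 0" "U1 a = 0" "U2 a = 0" by simp_all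
  then have ZJ: "J q R t = J 3 F t" if "t \<in> {a..b}" for t
    using U[OF that] by (simp add: U0_def Z_def)

  have JF: "continuous_on {a..b} (J \<alpha> F)" using \<alpha> F by (intro continuous_on_J) auto
  \<comment> \<open>Since q + \<alpha> = 3, I^q maps both R and I^\<alpha> F to I^3 F; injectivity
    of I^q for 0 < q < 1 identifies them.\<close>
  have RJ: "R t - J \<alpha> F t = 0" if "t \<in> {a..b}" for t
  proof (rule J_eq_0_imp_eq_0[OF q continuous_on_diff[OF R JF] _ that])
    fix s assume s: "s \<in> {a..b}"
    have "J q (J \<alpha> F) s = J 3 F s" using J_J[OF q(1) _ F s, of \<alpha>] \<alpha> by (simp add: q_def)
    then show "J q (\<lambda>t. R t - J \<alpha> F t) s = 0"
      using J_diff[OF q(1) R JF s] ZJ[OF s] by simp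
  qed
  show ?thesis
  proof (intro exI ballI)
    fix t assume "t \<in> {a..b}"
    from RJ[OF this]
    show "x t = J \<alpha> F t + x a + psi_deriv a b \<psi> x a * \<theta> t
        + psi_deriv a b \<psi> (psi_deriv a b \<psi> x) a / 2 * (\<theta> t)\<^sup>2"
      unfolding R_def psi_Taylor_3 by linarith
  qed
qed

text \<open>Here F stands for \<tau> \<mapsto> f(\<tau>, x(\<tau>)). The coefficients stay arbitrary
  so that the boundary lemma serves both directions: once with an unknown c2, once with c2 =
  \<open>\<gamma>\<^sub>x\<close>.\<close>

context
  fixes \<alpha> c0 c1 c2 :: real and F x :: "real \<Rightarrow> real"
  assumes \<alpha>: "2 < \<alpha>" "\<alpha> < 3"
    and F: "continuous_on {a..b} F"
    and Volterra: "\<And>t. t \<in> {a..b} \<Longrightarrow> x t = J \<alpha> F t + c0 + c1 * \<theta> t + c2 * (\<theta> t)\<^sup>2"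
begin

lemma Volterra_imp_has_psi_deriv:
  "has_psi_deriv x (\<lambda>t. J (\<alpha> - 1) F t + c1 + 2 * c2 * \<theta> t)"
  by (rule has_psi_deriv_cong[OF has_psi_deriv_add_quadratic[OF has_psi_deriv_J_Suc[OF _ F, of "\<alpha> - 1"], of c0 c1 c2]])
    (use \<alpha> in \<open>simp_all add: Volterra\<close>)

lemma Volterra_imp_initial: "x a = c0" "deriv_on a b x a = c1 * \<psi>' a"
  using Volterra[of a] deriv_on_eqI[OF ab _ has_psi_derivD[OF Volterra_imp_has_psi_deriv, of a]] ab
  by (auto simp: J_at_a)

text \<open>Subtracting the Taylor polynomial leaves exactly I^\<alpha> F. Then I^(3-\<alpha>)
  I^\<alpha> F = I^3 F, whose third \<psi>-derivative is F.\<close>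

lemma Volterra_imp_Caputo:
  assumes t: "t \<in> {a..b}"
  shows "psi_Caputo_deriv_exists a b \<psi> \<alpha> x t \<and> psi_Caputo_deriv a b \<psi> \<alpha> x t = F t"
proof -
  note [simp] = frac_order_eq_3[OF \<alpha>]
  have a: "a \<in> {a..b}" using ab by simp
  \<comment> \<open>The chain of \<psi>-derivatives of x up to order 2; values at larger indices are
    fillers.\<close>
  define G where "G = (\<lambda>k::nat. if k = 0 then x else if k = 1 then \<lambda>t. J (\<alpha> - 1) F t + c1 + 2 * c2 * \<theta> t
      else (\<lambda>t. J (\<alpha> - 2) F t + 2 * c2))"
  have "has_psi_deriv (\<lambda>t. J (\<alpha> - 1) F t + c1 + 2 * c2 * \<theta> t) (\<lambda>t. J (\<alpha> - 2) F t + 2 * c2)"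
    using has_psi_deriv_add_quadratic[OF has_psi_deriv_J_Suc[OF _ F, of "\<alpha> - 2"], of c1 "2 * c2" 0] \<alpha> by simp
  then have G: "has_psi_deriv (G k) (G (Suc k))" if "k < 2" for k
    using that Volterra_imp_has_psi_deriv by (auto simp: G_def less_2_cases_iff)
  have ex: "psi_deriv_exists k a b \<psi> x a" and Dx: "(psi_deriv a b \<psi> ^^ k) x a = G k a" if "k < 3" for k
    using psi_deriv_iterate[where G = G and n = 2 and k = k, OF G _ a] that by (auto simp: G_def)
  \<comment> \<open>The integrals of orders \<alpha> - 1 and \<alpha> - 2 vanish at a, leaving c0,
    c1 and 2 * c2; the last is divided by 2!.\<close>
  have T: "psi_Taylor a b \<psi> 3 x s = c0 + c1 * \<theta> s + c2 * (\<theta> s)\<^sup>2" for s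
    using Dx[of 1] Dx[of 2] Volterra_imp_initial(1) by (simp add: psi_Taylor_3 G_def J_at_a numeral_2_eq_2)
  define R where "R = (\<lambda>t. x t - psi_Taylor a b \<psi> 3 x t)"
  have R: "R s = J \<alpha> F s" if "s \<in> {a..b}" for s
    using Volterra[OF that] by (simp add: R_def T)
  have cR: "continuous_on {a..b} R"
    using \<alpha> by (intro continuous_on_eq[OF continuous_on_J[OF _ F]]) (auto simp: R)
  define q where "q = 3 - \<alpha>"
  have q: "q > 0" using \<alpha> by (simp add: q_def)
  have JR: "J q R s = J 3 F s" if "s \<in> {a..b}" for s
  proof -
    have "J q R s = J q (J \<alpha> F) s" using that by (intro J_cong R) auto
    then show ?thesis using J_J[OF q _ F that, of \<alpha>] \<alpha> by (simp add: q_def)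
  qed
  define H where "H = (\<lambda>k::nat. if k = 0 then J q R else if k = 1 then J 2 F else if k = 2 then J 1 F else F)"
  have "has_psi_deriv (J q R) (J 2 F)"
    by (rule has_psi_deriv_cong[OF has_psi_deriv_J_Suc[OF _ F, of 2]]) (simp_all add: JR)
  moreover have "has_psi_deriv (J 2 F) (J 1 F)"
    using has_psi_deriv_J_Suc[OF _ F, of 1] by simp
  ultimately have H: "has_psi_deriv (H k) (H (Suc k))" if "k < 3" for k
    using that has_psi_deriv_J_1[OF F] by (auto simp: H_def less_Suc_eq numeral_3_eq_3)
  have "(psi_deriv a b \<psi> ^^ 3) (J q R) t = F t" "psi_deriv_exists 3 a b \<psi> (J q R) t"
    using psi_deriv_iterate[where G = H and n = 3 and k = 3, OF H _ t] by (simp_all add: H_def)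
  moreover have "psi_integrand a b \<psi> q R s absolutely_integrable_on {a..s}" if "s \<in> {a..b}" for s
    by (rule absolutely_integrable_psi_integrand[OF q cR that])
  ultimately show ?thesis
    using ex by (simp add: psi_Caputo_deriv_exists_def psi_RL_deriv_exists_def psi_Caputo_deriv_def
        psi_RL_deriv_def R_def q_def)
qed

section \<open>The nonlocal boundary condition\<close>

lemma J_Volterra:
  assumes t: "t \<in> {a..b}"
  shows "J \<alpha> x t = J (2 * \<alpha>) F t + c0 / Gamma (1 + \<alpha>) * \<theta> t powr \<alpha>
    + c1 / Gamma (2 + \<alpha>) * \<theta> t powr (1 + \<alpha>) + 2 * c2 / Gamma (3 + \<alpha>) * \<theta> t powr (2 + \<alpha>)"
proof -
  have pos: "\<alpha> > 0" using \<alpha> by simp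
  note J = continuous_on_J[OF pos F]
  have "J \<alpha> x t = J \<alpha> (\<lambda>s. J \<alpha> F s + c0 * \<theta> s ^ 0 + c1 * \<theta> s ^ 1 + c2 * \<theta> s ^ 2) t"
    using t by (intro J_cong) (simp add: Volterra)
  also have "\<dots> = J \<alpha> (J \<alpha> F) t + c0 * J \<alpha> (\<lambda>s. \<theta> s ^ 0) t + c1 * J \<alpha> (\<lambda>s. \<theta> s ^ 1) t
      + c2 * J \<alpha> (\<lambda>s. \<theta> s ^ 2) t"
    unfolding J_cmult[symmetric]
    by (subst J_add[OF pos _ _ t], (intro continuous_intros J continuous_on_theta)+)+ (rule refl)
  also have "\<dots> = J (2 * \<alpha>) F t + c0 / Gamma (1 + \<alpha>) * \<theta> t powr \<alpha>
    + c1 / Gamma (2 + \<alpha>) * \<theta> t powr (1 + \<alpha>) + 2 * c2 / Gamma (3 + \<alpha>) * \<theta> t powr (2 + \<alpha>)"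
    unfolding J_theta_power[OF pos t] J_J[OF pos pos F t] by (simp add: add.commute)
  finally show ?thesis .
qed

text \<open>By \<open>J_Volterra\<close>, the defect \<open>x b - K * J \<alpha> x v\<close> is
  affine in c2 with slope -N, so N \<noteq> 0 gives exactly one admissible c2.\<close>

lemma Volterra_boundary_iff:
  assumes v: "v \<in> {a..b}"
    and N: "N = 2 * K / Gamma (3 + \<alpha>) * \<theta> v powr (2 + \<alpha>) - (\<theta> b)\<^sup>2" "N \<noteq> 0"
  shows "x b = K * J \<alpha> x v \<longleftrightarrow> c2 = 1 / N *
           (J \<alpha> F b - K * J (2 * \<alpha>) F v + c0 * (1 - K / Gamma (1 + \<alpha>) * \<theta> v powr \<alpha>)
            + c1 * (\<theta> b - K / Gamma (2 + \<alpha>) * \<theta> v powr (1 + \<alpha>)))"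
    (is "_ \<longleftrightarrow> c2 = 1 / N * ?P")
proof -
  have "x b - K * J \<alpha> x v = ?P - c2 * N"
    using Volterra[of b] ab unfolding J_Volterra[OF v] N(1) by (simp add: algebra_simps)
  then have "x b = K * J \<alpha> x v \<longleftrightarrow> c2 * N = ?P" by auto
  also have "\<dots> \<longleftrightarrow> c2 = 1 / N * ?P" using N(2) by (simp add: field_simps)
  finally show ?thesis .
qed

end

end

section \<open>Assembly of the equivalence\<close>

theorem theorem3:
  fixes a b v \<alpha> K x\<^sub>a x\<^sub>a1 N \<gamma>\<^sub>x :: real
    and \<psi> x :: "real \<Rightarrow> real"
    and f :: "real \<times> real \<Rightarrow> real"
  assumes "2 < \<alpha>" "\<alpha> < 3"
    and "v \<in> {a<..b}"
    and "continuous_on ({a..b} \<times> UNIV) f"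
    and "mono_on {a..b} \<psi>"
    and "\<psi> differentiable_on {a..b}"
    and "\<forall>t\<in>{a..b}. deriv_on a b \<psi> t \<noteq> 0"
    and "N = 2 * K / Gamma (3 + \<alpha>) * (\<psi> v - \<psi> a) powr (2 + \<alpha>) - (\<psi> b - \<psi> a)\<^sup>2"
    and "N \<noteq> 0"
    and "C_k_on 2 a b x"
    and "\<gamma>\<^sub>x = 1 / N *
           (psi_RL_integral a b \<psi> \<alpha> (\<lambda>\<tau>. f (\<tau>, x \<tau>)) b
            - K * psi_RL_integral a b \<psi> (2 * \<alpha>) (\<lambda>\<tau>. f (\<tau>, x \<tau>)) v
            + x\<^sub>a * (1 - K / Gamma (1 + \<alpha>) * (\<psi> v - \<psi> a) powr \<alpha>)
            + x\<^sub>a1 / deriv_on a b \<psi> a *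
                (\<psi> b - \<psi> a - K / Gamma (2 + \<alpha>) * (\<psi> v - \<psi> a) powr (1 + \<alpha>)))"
  shows "((\<forall>t\<in>{a..b}. psi_Caputo_deriv_exists a b \<psi> \<alpha> x t \<and>
                        psi_Caputo_deriv a b \<psi> \<alpha> x t = f (t, x t)) \<and>
          x a = x\<^sub>a \<and>
          deriv_on a b x a = x\<^sub>a1 \<and>
          x b = K * psi_RL_integral a b \<psi> \<alpha> x v)
         \<longleftrightarrow>
         (\<forall>t\<in>{a..b}. x t =
            psi_RL_integral a b \<psi> \<alpha> (\<lambda>\<tau>. f (\<tau>, x \<tau>)) t
            + x\<^sub>a + x\<^sub>a1 / deriv_on a b \<psi> a * (\<psi> t - \<psi> a) + \<gamma>\<^sub>x * (\<psi> t - \<psi> a)\<^sup>2)"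
proof -
  \<comment> \<open>The inequality a < b comes from \<open>v \<in> {a<..b}\<close>.\<close>
  interpret scale_function a b \<psi>
    using assms(3,5,6,7) by unfold_locales auto
  define F where "F = (\<lambda>\<tau>. f (\<tau>, x \<tau>))"
  have a: "a \<in> {a..b}" and v: "v \<in> {a..b}" using assms(3) by auto
  have x: "x differentiable_on {a..b}"
    using assms(10) by (auto simp: C_k_on_def dest: spec[of _ 0])
  have F: "continuous_on {a..b} F"
    unfolding F_def
    by (rule continuous_on_compose2[OF assms(4)])
      (auto intro!: continuous_intros differentiable_imp_continuous_on[OF x])
  have N: "N = 2 * K / Gamma (3 + \<alpha>) * \<theta> v powr (2 + \<alpha>) - (\<theta> b)\<^sup>2"
    using assms(8) by (simp add: \<theta>_def)
  have \<gamma>: "\<gamma>\<^sub>x = 1 / N *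
           (J \<alpha> F b - K * J (2 * \<alpha>) F v + x\<^sub>a * (1 - K / Gamma (1 + \<alpha>) * \<theta> v powr \<alpha>)
            + x\<^sub>a1 / \<psi>' a * (\<theta> b - K / Gamma (2 + \<alpha>) * \<theta> v powr (1 + \<alpha>)))"
    using assms(11) by (simp add: \<theta>_def F_def)
  have "((\<forall>t\<in>{a..b}. psi_Caputo_deriv_exists a b \<psi> \<alpha> x t \<and> psi_Caputo_deriv a b \<psi> \<alpha> x t = F t) \<and>
      x a = x\<^sub>a \<and> deriv_on a b x a = x\<^sub>a1 \<and> x b = K * J \<alpha> x v)
    \<longleftrightarrow> (\<forall>t\<in>{a..b}. x t = J \<alpha> F t + x\<^sub>a + x\<^sub>a1 / \<psi>' a * \<theta> t + \<gamma>\<^sub>x * (\<theta> t)\<^sup>2)"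
    (is "?problem \<longleftrightarrow> ?equation")
  proof
    assume ?problem
    then have C: "\<And>t. t \<in> {a..b} \<Longrightarrow> psi_Caputo_deriv_exists a b \<psi> \<alpha> x t"
        "\<And>t. t \<in> {a..b} \<Longrightarrow> psi_Caputo_deriv a b \<psi> \<alpha> x t = F t"
      and xa: "x a = x\<^sub>a" "psi_deriv a b \<psi> x a = x\<^sub>a1 / \<psi>' a"
      and xb: "x b = K * J \<alpha> x v"
      by (auto simp: psi_deriv_def)
    obtain c where c: "\<And>t. t \<in> {a..b} \<Longrightarrow> x t = J \<alpha> F t + x\<^sub>a + x\<^sub>a1 / \<psi>' a * \<theta> t + c * (\<theta> t)\<^sup>2"
      using Caputo_imp_Volterra[OF assms(1,2) F x C] unfolding xa by blast
    \<comment> \<open>The integral equation holds with some c; the boundary condition forces it to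
      be \<open>\<gamma>\<^sub>x\<close>.\<close>
    from Volterra_boundary_iff[OF assms(1,2) F c v N assms(9)] xb have "c = \<gamma>\<^sub>x"
      unfolding \<gamma> by blast
    with c show ?equation by blast
  next
    assume ?equation
    then have eq: "\<And>t. t \<in> {a..b} \<Longrightarrow> x t = J \<alpha> F t + x\<^sub>a + x\<^sub>a1 / \<psi>' a * \<theta> t + \<gamma>\<^sub>x * (\<theta> t)\<^sup>2"
      by blast
    note facts = assms(1,2) F eq
    show ?problem
      using Volterra_imp_Caputo[OF facts] Volterra_imp_initial[OF facts] psi'_pos[OF a]
        Volterra_boundary_iff[OF facts v N assms(9)] \<gamma>
      by simp
  qed
  then show ?thesis unfolding F_def \<theta>_def .
qed

end
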